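(* Let $0<\alpha<1$ be fixed. Then there exist infinitely many integers $N\ge 1$ such that, with $n$ denoting the number of binary digits of $N$ (so that $N$ is an $n$-bit integer), $N$ is $Y^{1+o(1)}$-smooth, where $$ Y=\exp\left(2^{1/2}e^{-\gamma}\alpha^{-1/2}\left(\log N\right)^{1/2}\left(\log\log\log N\right)^{-1}\right), $$ and $N$ has at most $$ \alpha n+O\left(n^{1/2}\log n\right) $$ non-zero digits in its binary expansion.
   Context: A positive integer is called $y$-smooth if it has no prime divisor $p>y$. An $n$-bit integer is a positive integer whose binary expansion has exactly $n$ digits. $\gamma$ denotes the Euler–Mascheroni constant and $\log$ the natural logarithm. The quantity $o(1)$ tends to $0$ as $N\to\infty$ through the infinite set of integers whose existence is asserted. $U=O(V)$ means $|U|\le cV$ for some positive absolute constant $c$. *)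

theory Defs
  imports "HOL-Analysis.Analysis" "HOL-Library.Log_Nat"
begin

definition smooth :: "real \<Rightarrow> nat \<Rightarrow> bool" where
  "smooth y N \<longleftrightarrow> N > 0 \<and> \<not> (\<exists>p. prime p \<and> p dvd N \<and> real p > y)"

text \<open>For positive \<open>N\<close>, \<open>floorlog 2 N = nat \<lfloor>log 2 N\<rfloor> + 1\<close>.\<close>

definition num_bits :: "nat \<Rightarrow> nat" where
  "num_bits N = floorlog 2 N"

definition nonzero_bits :: "nat \<Rightarrow> nat" where
  "nonzero_bits N = card {k. bit N k}"

text \<open>The iterated logarithm is positive only for \<open>N \<ge> 16\<close>; for smaller \<open>N\<close> the value of
  \<open>smooth_level\<close> carries no meaning.\<close>

definition smooth_level :: "real \<Rightarrow> nat \<Rightarrow> real" where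
  "smooth_level \<alpha> N =
     exp (2 powr (1/2) * exp (- euler_mascheroni) * \<alpha> powr (- 1/2)
          * ln (real N) powr (1/2) * inverse (ln (ln (ln (real N)))))"

end

theory Submission
  imports Defs "HOL-Number_Theory.Number_Theory" "HOL-Real_Asymp.Real_Asymp"
begin

text \<open>
  The integers are \<open>N = (2^k + 1)^m\<close>, where \<open>2k = K\<close> is the product of the primes up to \<open>z\<close>
  and \<open>m = \<lfloor>2\<alpha>k ln 2\<rfloor>\<close>.

  Sparseness. By the binomial theorem \<open>N\<close> is the sum of the shifted binomial coefficients
  \<open>2^(kj) (m choose j)\<close>, and the binary digit sum is subadditive, so \<open>N\<close> has at most about
  \<open>\<Sum>\<^sub>j log\<^sub>2 (m choose j)\<close> non-zero digits (\<open>nonzero_bits_power_le\<close>). The product of the binomial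
  coefficients of order \<open>m\<close> is at most \<open>exp (m(m+1)/2)\<close>, which turns this count into
  \<open>m\<^sup>2/(2 ln 2) + O(m)\<close>. Since \<open>N\<close> has more than \<open>km\<close> digits, the choice of \<open>m\<close> makes the main
  term at most \<open>\<alpha>n\<close> and the error \<open>O(\<surd>n)\<close>.

  Smoothness. A prime \<open>p\<close> dividing \<open>N\<close> divides \<open>2^K - 1\<close>. If \<open>d\<close> is the order of \<open>2\<close> modulo \<open>p\<close>,
  then \<open>p\<close> divides \<open>2^d - 1\<close> but none of the numbers \<open>2^(d/q) - 1\<close> with \<open>q\<close> a prime divisor of \<open>d\<close>,
  so it divides the quotient of \<open>2^d - 1\<close> by their least common multiple. That quotient is the value
  at \<open>2\<close> of the \<open>d\<close>-th cyclotomic polynomial; inclusion-exclusion bounds it by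
  \<open>2^(\<phi>(d) + 2^(\<omega>(d)))\<close> (\<open>prime_divisor_mersenne_bound\<close>). For a primorial \<open>K\<close> the term
  \<open>2^(\<omega>(K))\<close> is negligible against \<open>\<phi>(K)\<close>, and \<open>\<phi>(K)/K = \<Prod>\<^sub>p\<^sub>\<le>\<^sub>z (1 - 1/p)\<close> is
  at most \<open>(1 + o(1)) e^(-\<gamma>)/ln z\<close> for suitable \<open>z\<close>, by the next paragraph. As \<open>ln N\<close> is about \<open>2\<alpha>(k ln 2)\<^sup>2\<close> and
  \<open>ln ln ln N \<le> (1 + o(1)) ln z\<close>, the bound \<open>\<phi>(K) ln 2\<close> is then at most \<open>(1 + o(1)) ln Y\<close>.

  Mertens' product. The bound is required only for arbitrarily large \<open>z\<close>, so it is enough that an inequality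
  \<open>\<Sum>\<^sub>p\<^sub>\<le>\<^sub>n -ln (1 - 1/p) \<le> C + ln ln n\<close> for all large \<open>n\<close> forces \<open>C \<ge> \<gamma>\<close>
  (\<open>euler_mascheroni_le_mertens_bound\<close>). This is the easy, Abelian direction: summation by parts
  transfers the inequality to \<open>ln \<zeta>(1+e)\<close>, which is at least \<open>ln (1/e)\<close>, and in the limit
  \<open>e \<rightarrow> 0\<close> the comparison says \<open>0 \<le> C + \<integral>\<^sub>0\<^sup>\<infinity> e\<^sup>-\<^sup>u ln u du = C + \<Gamma>'(1) = C - \<gamma>\<close>. The integral is
  reached through \<open>ln u \<le> (u^\<delta> - 1)/\<delta>\<close>, whose integral is a difference quotient of \<open>\<Gamma>\<close> at \<open>1\<close>.
\<close>

section \<open>A lower bound for Mertens' sum at infinitely many points\<close>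

text \<open>
  One half of the Euler product, over a finite set of primes. When a prime \<open>p\<close> joins \<open>P\<close>, an admissible
  \<open>n\<close> divisible by \<open>p\<close> is \<open>p\<close> times an admissible number, so the new sum \<open>B\<close> and the old sum \<open>A\<close> satisfy
  \<open>B \<le> A + p\<^sup>-\<^sup>s B\<close>.
\<close>

lemma sum_powr_le_euler_product:
  fixes s :: real
  assumes "finite P" "\<And>p. p \<in> P \<Longrightarrow> prime p" "s > 0"
  shows "(\<Sum>n | n \<in> {1..x} \<and> prime_factors n \<subseteq> P. real n powr (-s))
           \<le> (\<Prod>p\<in>P. inverse (1 - real p powr (-s)))"
  using assms
proof (induction P rule: finite_induct)
  case empty
  have "{n \<in> {1..x}. prime_factors n \<subseteq> {}} \<subseteq> {1}"
    by (auto simp: prime_factorization_empty_iff)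
  then have "(\<Sum>n | n \<in> {1..x} \<and> prime_factors n \<subseteq> {}. real n powr (-s))
      \<le> (\<Sum>n\<in>{1}. real n powr (-s))"
    by (intro sum_mono2) auto
  then show ?case by simp
next
  case (insert p P)
  define A where "A = {n \<in> {1..x}. prime_factors n \<subseteq> P}"
  define B where "B = {n \<in> {1..x}. prime_factors n \<subseteq> insert p P}"
  let ?f = "\<lambda>n. real n powr (-s)"
  have fin: "finite A" "finite B" by (auto simp: A_def B_def)
  have p: "prime p" "p > 1" using insert.prems prime_gt_1_nat by auto
  have fp: "?f p < 1" "?f p > 0" using p insert.prems by (auto intro!: powr_less_one)
  have "B \<subseteq> A \<union> (*) p ` B"
  proof
    fix n assume n: "n \<in> B"
    show "n \<in> A \<union> (*) p ` B"
    proof (cases "p dvd n")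
      case True
      then obtain m where m: "n = p * m" by blast
      then have "m dvd n" "m > 0" using n by (auto simp: B_def intro: gr0I)
      then have "m \<in> B"
        using n dvd_prime_factors[of n m] dvd_imp_le[of m n] by (auto simp: B_def)
      then show ?thesis using m by blast
    next
      case False
      then show ?thesis using n by (auto simp: A_def B_def)
    qed
  qed
  then have "sum ?f B \<le> sum ?f (A \<union> (*) p ` B)" using fin by (intro sum_mono2) auto
  also have "\<dots> \<le> sum ?f A + sum ?f ((*) p ` B)"
    using fin by (simp add: sum_Un sum_nonneg)
  also have "sum ?f ((*) p ` B) = (\<Sum>n\<in>B. ?f (p * n))"
    using p by (intro sum.reindex_cong[of "(*) p"]) (auto simp: inj_on_def)
  also have "\<dots> = ?f p * sum ?f B" by (simp add: powr_mult sum_distrib_left)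
  finally have "sum ?f B * (1 - ?f p) \<le> sum ?f A" by (simp add: algebra_simps)
  then have "sum ?f B \<le> sum ?f A * inverse (1 - ?f p)"
    using fp by (simp add: field_simps)
  also have "\<dots> \<le> (\<Prod>q\<in>P. inverse (1 - ?f q)) * inverse (1 - ?f p)"
    using fp insert.IH insert.prems by (intro mult_right_mono) (auto simp: A_def)
  also have "\<dots> = (\<Prod>q\<in>insert p P. inverse (1 - ?f q))"
    using insert.hyps by simp
  finally show ?case by (simp add: B_def)
qed

lemma powr_diff_le:
  fixes e :: real
  assumes "e > 0" "n \<ge> 1"
  shows "real n powr (-e) - real (Suc n) powr (-e) \<le> e * real n powr (-(1 + e))"
proof -
  have "\<exists>z. real n < z \<and> z < real (Suc n) \<and>
      real (Suc n) powr (-e) - real n powr (-e) = (real (Suc n) - real n) * (-e * z powr (-e - 1))"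
    using assms by (intro MVT2) (auto intro!: derivative_eq_intros simp: powr_diff field_simps)
  then obtain z where z: "real n < z"
      "real (Suc n) powr (-e) - real n powr (-e) = -e * z powr (-e - 1)" by auto
  have "z powr (-e - 1) \<le> real n powr (-e - 1)"
    using z(1) assms by (intro powr_mono2') auto
  then have "e * z powr (-e - 1) \<le> e * real n powr (-e - 1)" using assms by (intro mult_left_mono) auto
  moreover have eq: "-(1 + e) = -e - 1" by simp
  ultimately show ?thesis using z(2) unfolding eq by linarith
qed

text \<open>
  The left-hand side is the integral of \<open>t\<^sup>-\<^sup>1\<^sup>-\<^sup>e\<close> over \<open>[1, x+1]\<close>, here obtained by telescoping.
\<close>

lemma zeta_partial_sum_ge:
  fixes e :: real
  assumes "e > 0"
  shows "(1 - real (Suc x) powr (-e)) / e \<le> (\<Sum>n\<in>{1..x}. real n powr (-(1 + e)))"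
proof (induction x)
  case (Suc x)
  have "(real (Suc x) powr (-e) - real (Suc (Suc x)) powr (-e)) / e \<le> real (Suc x) powr (-(1 + e))"
    using powr_diff_le[OF assms, of "Suc x"] assms by (subst pos_divide_le_eq) (auto simp: mult.commute)
  with Suc show ?case by (simp add: diff_divide_distrib)
qed (use assms in auto)

definition prime_weight :: "nat \<Rightarrow> real" where
  "prime_weight n = (if prime n then - ln (1 - 1 / real n) else 0)"

text \<open>
  The negative logarithm of Mertens' product \<open>\<Prod>\<^sub>p\<^sub>\<le>\<^sub>x (1 - 1/p)\<close>, written over all \<open>n \<le> x\<close> so that
  summation by parts applies directly.
\<close>

definition mertens_sum :: "nat \<Rightarrow> real" where
  "mertens_sum x = (\<Sum>n\<in>{1..x}. prime_weight n)"

lemma prime_weight_nonneg: "prime_weight n \<ge> 0"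
proof (cases "prime n")
  case True
  then have "n > 1" by (rule prime_gt_1_nat)
  then show ?thesis using True by (auto simp: prime_weight_def ln_le_zero_iff)
qed (simp add: prime_weight_def)

lemma mertens_sum_mono: "x \<le> y \<Longrightarrow> mertens_sum x \<le> mertens_sum y"
  unfolding mertens_sum_def by (intro sum_mono2) (auto simp: prime_weight_nonneg)

text \<open>
  Concavity of \<open>ln\<close>. With \<open>t = p\<^sup>-\<^sup>e\<close> and \<open>y = 1/p\<close> it bounds the Euler factor at \<open>1 + e\<close> by a multiple of
  the factor at \<open>1\<close>, so prime powers never have to be treated separately.
\<close>

lemma neg_ln_one_minus_mult_le:
  fixes t y :: real
  assumes "0 \<le> t" "t \<le> 1" "0 \<le> y" "y < 1"
  shows "- ln (1 - t * y) \<le> t * (- ln (1 - y))"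
proof -
  have "(1 - t) * ln 1 + t * ln (1 - y) \<le> ln ((1 - t) *\<^sub>R 1 + t *\<^sub>R (1 - y))"
    using concave_onD[OF ln_concave, of t 1 "1 - y"] assms by simp
  then show ?thesis by (simp add: algebra_simps)
qed

lemma ln_zeta_partial_sum_le:
  fixes e :: real
  assumes "e > 0" "x \<ge> 1"
  shows "ln ((1 - real (Suc x) powr (-e)) / e) \<le> (\<Sum>n\<in>{1..x}. prime_weight n * real n powr (-e))"
proof -
  define P where "P = {p \<in> {1..x}. prime p}"
  have fin: "finite P" by (simp add: P_def)
  have small: "real p powr (-(1 + e)) < 1" if "p \<in> P" for p
    using that assms by (auto simp: P_def intro!: powr_less_one dest: prime_gt_1_nat)
  have pos: "0 < (1 - real (Suc x) powr (-e)) / e"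
    using assms by (auto intro!: divide_pos_pos powr_less_one)
  have "(1 - real (Suc x) powr (-e)) / e \<le> (\<Sum>n\<in>{1..x}. real n powr (-(1 + e)))"
    by (rule zeta_partial_sum_ge) fact
  also have "{1..x} = {n \<in> {1..x}. prime_factors n \<subseteq> P}"
    by (auto simp: P_def in_prime_factors_iff dest!: dvd_imp_le intro: Suc_leI prime_gt_0_nat)
  also have "(\<Sum>n\<in>\<dots>. real n powr (-(1 + e))) \<le> (\<Prod>p\<in>P. inverse (1 - real p powr (-(1 + e))))"
    by (rule sum_powr_le_euler_product) (use assms in \<open>auto simp: P_def\<close>)
  finally have "ln ((1 - real (Suc x) powr (-e)) / e) \<le> ln (\<Prod>p\<in>P. inverse (1 - real p powr (-(1 + e))))"
    using pos by simp
  also have "\<dots> = (\<Sum>p\<in>P. - ln (1 - real p powr (-(1 + e))))"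
    using small fin by (subst ln_prod) (auto simp: ln_inverse dest: small)
  also have "\<dots> \<le> (\<Sum>p\<in>P. prime_weight p * real p powr (-e))"
  proof (rule sum_mono)
    fix p assume "p \<in> P"
    then have p: "prime p" "p > 1" using prime_gt_1_nat[of p] by (auto simp: P_def)
    have "real p powr (-(1 + e)) = real p powr (-e) * (1 / real p)"
      using p by (simp add: powr_diff powr_minus field_simps powr_add)
    moreover have "real p powr (-e) \<le> 1" using p assms by (intro less_imp_le powr_less_one) auto
    ultimately show "- ln (1 - real p powr (-(1 + e))) \<le> prime_weight p * real p powr (-e)"
      using neg_ln_one_minus_mult_le[of "real p powr (-e)" "1 / real p"] p
      by (simp add: prime_weight_def mult.commute)
  qed
  also have "\<dots> = (\<Sum>n\<in>{1..x}. prime_weight n * real n powr (-e))"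
    by (rule sum.mono_neutral_left) (auto simp: P_def prime_weight_def)
  finally show ?thesis .
qed

lemma abel_summation:
  fixes b f :: "nat \<Rightarrow> real"
  assumes "x \<ge> 1"
  shows "(\<Sum>n\<in>{1..x}. b n * f n)
    = (\<Sum>i\<in>{1..x}. b i) * f x + (\<Sum>n\<in>{1..<x}. (\<Sum>i\<in>{1..n}. b i) * (f n - f (Suc n)))"
  using assms by (induction x rule: dec_induct) (simp_all add: algebra_simps)

text \<open>
  After the substitution \<open>u = e ln t\<close> the sum is a lower Riemann-Stieltjes sum of the increasing function
  \<open>u\<^sup>d\<close> against the measure \<open>e\<^sup>-\<^sup>u du\<close>, which gives the interval from \<open>e ln n\<close> to \<open>e ln (n+1)\<close> exactly the
  mass \<open>n\<^sup>-\<^sup>e - (n+1)\<^sup>-\<^sup>e\<close>.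
\<close>

lemma exp_weight_sum_le_Gamma:
  fixes e d :: real
  assumes "e > 0" "d > 0" "x \<ge> 1"
  shows "(\<Sum>n\<in>{1..<x}. (real n powr (-e) - real (Suc n) powr (-e)) * (e * ln (real n)) powr d)
           \<le> Gamma (1 + d)"
proof -
  let ?g = "\<lambda>u::real. u powr d / exp u"
  have Gam: "(?g has_integral Gamma (1 + d)) {0..}"
    using Gamma_integral_real[of "1 + d"] assms by simp
  have int: "?g integrable_on {a..b}" if "a \<ge> 0" for a b
    using Gam that by (intro integrable_on_subinterval[of ?g "{0..}"]) (auto simp: integrable_on_def)
  have "(\<Sum>n\<in>{1..<x}. (real n powr (-e) - real (Suc n) powr (-e)) * (e * ln (real n)) powr d)
      \<le> integral {0..e * ln (real x)} ?g"
    using \<open>x \<ge> 1\<close>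
  proof (induction x rule: dec_induct)
    case base
    then show ?case by simp
  next
    case (step n)
    let ?a = "e * ln (real n)" and ?b = "e * ln (real (Suc n))"
    have ab: "0 \<le> ?a" "?a \<le> ?b" using step assms by auto
    have ex: "exp (- ?a) = real n powr (-e)" "exp (- ?b) = real (Suc n) powr (-e)"
      using step by (auto simp: powr_def)
    have "((\<lambda>u. exp (-u) * ?a powr d) has_integral
        (- exp (- ?b) * ?a powr d - (- exp (- ?a) * ?a powr d))) {?a..?b}"
      by (rule fundamental_theorem_of_calculus[OF ab(2)])
        (auto intro!: derivative_eq_intros simp flip: has_real_derivative_iff_has_vector_derivative)
    then have I: "((\<lambda>u. exp (-u) * ?a powr d) has_integral
        ((real n powr (-e) - real (Suc n) powr (-e)) * ?a powr d)) {?a..?b}"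
      unfolding ex by (simp add: algebra_simps)
    have "(real n powr (-e) - real (Suc n) powr (-e)) * ?a powr d \<le> integral {?a..?b} ?g"
    proof (rule has_integral_le[OF I integrable_integral[OF int[OF ab(1)]]])
      fix u assume "u \<in> {?a..?b}"
      then have "?a powr d \<le> u powr d" using ab assms by (intro powr_mono2) auto
      then show "exp (-u) * ?a powr d \<le> ?g u" by (simp add: exp_minus field_simps)
    qed
    moreover have "integral {0..?a} ?g + integral {?a..?b} ?g = integral {0..?b} ?g"
      using ab int by (intro Henstock_Kurzweil_Integration.integral_combine) auto
    ultimately show ?case using step by simp
  qed
  also have "\<dots> \<le> integral {0..} ?g"
    using Gam assms by (intro integral_subset_le int) (auto simp: integrable_on_def)
  also have "\<dots> = Gamma (1 + d)" using Gam by (rule integral_unique)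
  finally show ?thesis .
qed

text \<open>
  Summation by parts, with the hypothesis used from \<open>Z\<close> on and monotonicity of the sum below \<open>Z\<close>. The double
  logarithm is linearized by \<open>ln ln n = ln (1/e) + ln (e ln n)\<close> and \<open>ln u \<le> (u\<^sup>d - 1)/d\<close>, so that
  only total masses of the weights and a Gamma integral remain.
\<close>

lemma mertens_finite_inequality:
  fixes e d C :: real
  assumes bound: "\<And>n. n \<ge> Z \<Longrightarrow> mertens_sum n \<le> C + ln (ln (real n))"
    and "Z \<ge> 3" "x \<ge> Z" "e > 0" "d > 0"
  shows "ln ((1 - real (Suc x) powr (-e)) / e)
    \<le> real x powr (-e) * (C + ln (ln (real x))) + mertens_sum Z * (1 - real Z powr (-e))
      + (real Z powr (-e) - real x powr (-e)) * (C + ln (1 / e) - 1 / d) + Gamma (1 + d) / d"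
proof -
  define w where "w n = real n powr (-e) - real (Suc n) powr (-e)" for n
  have w: "w n \<ge> 0" if "n \<ge> 1" for n
    using that assms by (auto simp: w_def intro!: powr_mono2')
  have tele: "(\<Sum>n\<in>{a..<b}. w n) = real a powr (-e) - real b powr (-e)" if "a \<le> b" for a b
    unfolding w_def using sum_Suc_diff'[OF that, of "\<lambda>n. - (real n powr (-e))"] by simp
  have small: "(\<Sum>n\<in>{1..<Z}. mertens_sum n * w n) \<le> (\<Sum>n\<in>{1..<Z}. mertens_sum Z * w n)"
    by (intro sum_mono mult_right_mono mertens_sum_mono w) auto
  have large: "mertens_sum n * w n
      \<le> w n * (C + ln (1 / e) - 1 / d) + (w n * (e * ln (real n)) powr d) / d"
    if "n \<ge> Z" for n
  proof -
    have L: "ln (real n) > 0" "e * ln (real n) > 0" using that assms by auto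
    have "ln ((e * ln (real n)) powr d) \<le> (e * ln (real n)) powr d - 1"
      using L by (intro ln_le_minus_one) auto
    then have "d * ln (e * ln (real n)) \<le> (e * ln (real n)) powr d - 1"
      using L by (simp add: ln_powr)
    then have "ln (e * ln (real n)) \<le> ((e * ln (real n)) powr d - 1) / d"
      using assms by (simp add: field_simps)
    then have "ln (ln (real n)) \<le> ln (1 / e) + ((e * ln (real n)) powr d - 1) / d"
      using L assms by (simp add: ln_mult ln_div)
    then have "mertens_sum n \<le> (C + ln (1 / e) - 1 / d) + (e * ln (real n)) powr d / d"
      using bound[OF that] by (simp add: diff_divide_distrib)
    then have "mertens_sum n * w n \<le> ((C + ln (1 / e) - 1 / d) + (e * ln (real n)) powr d / d) * w n"
      using w[of n] that assms by (intro mult_right_mono) auto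
    then show ?thesis by (simp add: algebra_simps)
  qed
  have "(\<Sum>n\<in>{Z..<x}. w n * (e * ln (real n)) powr d) \<le> (\<Sum>n\<in>{1..<x}. w n * (e * ln (real n)) powr d)"
    using assms w by (intro sum_mono2) auto
  also have "\<dots> \<le> Gamma (1 + d)"
    unfolding w_def using assms by (intro exp_weight_sum_le_Gamma) auto
  finally have gam: "(\<Sum>n\<in>{Z..<x}. w n * (e * ln (real n)) powr d) / d \<le> Gamma (1 + d) / d"
    using assms by (intro divide_right_mono) auto
  have "ln ((1 - real (Suc x) powr (-e)) / e) \<le> (\<Sum>n\<in>{1..x}. prime_weight n * real n powr (-e))"
    using assms by (intro ln_zeta_partial_sum_le) auto
  also have "\<dots> = mertens_sum x * real x powr (-e) + (\<Sum>n\<in>{1..<x}. mertens_sum n * w n)"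
    unfolding mertens_sum_def w_def using assms by (intro abel_summation) auto
  also have "{1..<x} = {1..<Z} \<union> {Z..<x}" using assms by auto
  also have "(\<Sum>n\<in>{1..<Z} \<union> {Z..<x}. mertens_sum n * w n)
      = (\<Sum>n\<in>{1..<Z}. mertens_sum n * w n) + (\<Sum>n\<in>{Z..<x}. mertens_sum n * w n)"
    by (rule sum.union_disjoint) auto
  also have "(\<Sum>n\<in>{Z..<x}. mertens_sum n * w n)
      \<le> (\<Sum>n\<in>{Z..<x}. w n * (C + ln (1 / e) - 1 / d) + (w n * (e * ln (real n)) powr d) / d)"
    by (intro sum_mono large) auto
  also have "\<dots> = (real Z powr (-e) - real x powr (-e)) * (C + ln (1 / e) - 1 / d)
      + (\<Sum>n\<in>{Z..<x}. w n * (e * ln (real n)) powr d) / d"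
    using assms by (simp add: sum.distrib tele sum_divide_distrib flip: sum_distrib_right)
  also note gam
  also note small
  also have "(\<Sum>n\<in>{1..<Z}. mertens_sum Z * w n) = mertens_sum Z * (1 - real Z powr (-e))"
    using assms by (simp add: tele flip: sum_distrib_left)
  also have "mertens_sum x * real x powr (-e) \<le> (C + ln (ln (real x))) * real x powr (-e)"
    using bound[of x] assms by (intro mult_right_mono) auto
  finally show ?thesis by (simp add: algebra_simps)
qed

text \<open>
  The limits \<open>x \<rightarrow> \<infinity>\<close>, \<open>e \<rightarrow> 0\<close>, \<open>d \<rightarrow> 0\<close> of the finite inequality, in this order. In the second one
  the terms \<open>ln (1/e)\<close> of both sides cancel because \<open>(1 - Z\<^sup>-\<^sup>e) ln (1/e)\<close> tends to \<open>0\<close>; in the last one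
  \<open>(\<Gamma>(1+d) - 1)/d\<close> tends to \<open>\<Gamma>'(1) = -\<gamma>\<close>.
\<close>

lemma euler_mascheroni_le_mertens_bound:
  fixes C :: real
  assumes bound: "\<And>n. n \<ge> Z \<Longrightarrow> mertens_sum n \<le> C + ln (ln (real n))" and "Z \<ge> 3"
  shows "euler_mascheroni \<le> C"
proof -
  have Z: "real Z > 1" using assms by simp
  let ?M = "mertens_sum Z"
  have step1: "ln (1 / e) \<le> ?M * (1 - real Z powr (-e)) + real Z powr (-e) * (C + ln (1 / e) - 1 / d)
      + Gamma (1 + d) / d" if "e > 0" "d > 0" for e d
  proof (rule tendsto_le[OF sequentially_bot])
    show "(\<lambda>x. real x powr (-e) * (C + ln (ln (real x))) + ?M * (1 - real Z powr (-e))
      + (real Z powr (-e) - real x powr (-e)) * (C + ln (1 / e) - 1 / d) + Gamma (1 + d) / d)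
      \<longlonglongrightarrow> ?M * (1 - real Z powr (-e)) + real Z powr (-e) * (C + ln (1 / e) - 1 / d)
      + Gamma (1 + d) / d"
    proof -
      have "(\<lambda>x. real x powr (-e) * (C + ln (ln (real x)))) \<longlonglongrightarrow> 0"
        using that by real_asymp
      moreover have "(\<lambda>x. real x powr (-e)) \<longlonglongrightarrow> 0" using that by real_asymp
      ultimately have "(\<lambda>x. real x powr (-e) * (C + ln (ln (real x))) + ?M * (1 - real Z powr (-e))
        + (real Z powr (-e) - real x powr (-e)) * (C + ln (1 / e) - 1 / d) + Gamma (1 + d) / d)
        \<longlonglongrightarrow> 0 + ?M * (1 - real Z powr (-e)) + (real Z powr (-e) - 0) * (C + ln (1 / e) - 1 / d)
        + Gamma (1 + d) / d"
        by (intro tendsto_add tendsto_diff tendsto_mult tendsto_const)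
      then show ?thesis by simp
    qed
    show "(\<lambda>x. ln ((1 - real (Suc x) powr (-e)) / e)) \<longlonglongrightarrow> ln (1 / e)"
    proof -
      have "(\<lambda>x. real (Suc x) powr (-e)) \<longlonglongrightarrow> 0" using that by real_asymp
      then have "(\<lambda>x. ln ((1 - real (Suc x) powr (-e)) / e)) \<longlonglongrightarrow> ln ((1 - 0) / e)"
        using that by (intro tendsto_ln tendsto_divide tendsto_diff tendsto_const) auto
      then show ?thesis by simp
    qed
    show "\<forall>\<^sub>F x in sequentially. ln ((1 - real (Suc x) powr (-e)) / e) \<le>
        real x powr (-e) * (C + ln (ln (real x))) + ?M * (1 - real Z powr (-e))
      + (real Z powr (-e) - real x powr (-e)) * (C + ln (1 / e) - 1 / d) + Gamma (1 + d) / d"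
      using eventually_ge_at_top[of Z]
      by eventually_elim (use assms that in \<open>intro mertens_finite_inequality; auto\<close>)
  qed
  have step2: "0 \<le> C + (Gamma (1 + d) - 1) / d" if "d > 0" for d
  proof (rule tendsto_le[OF trivial_limit_at_right_real])
    show "((\<lambda>e. ?M * (1 - real Z powr (-e)) + real Z powr (-e) * (C - 1 / d)
        + Gamma (1 + d) / d - ln (1 / e) * (1 - real Z powr (-e))) \<longlongrightarrow> C + (Gamma (1 + d) - 1) / d)
        (at_right 0)"
    proof -
      have "((\<lambda>e. real Z powr (-e)) \<longlongrightarrow> 1) (at_right 0)" using Z by real_asymp
      moreover have "((\<lambda>e. ln (1 / e) * (1 - real Z powr (-e))) \<longlongrightarrow> 0) (at_right 0)"
        using Z by real_asymp
      ultimately have "((\<lambda>e. ?M * (1 - real Z powr (-e)) + real Z powr (-e) * (C - 1 / d)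
        + Gamma (1 + d) / d - ln (1 / e) * (1 - real Z powr (-e))) \<longlongrightarrow>
        ?M * (1 - 1) + 1 * (C - 1 / d) + Gamma (1 + d) / d - 0) (at_right 0)"
        by (intro tendsto_intros)
      then show ?thesis by (simp add: diff_divide_distrib add_diff_eq diff_add_eq)
    qed
    show "((\<lambda>e::real. 0::real) \<longlongrightarrow> 0) (at_right 0)" by simp
    show "\<forall>\<^sub>F e in at_right 0. 0 \<le> ?M * (1 - real Z powr (-e)) + real Z powr (-e) * (C - 1 / d)
        + Gamma (1 + d) / d - ln (1 / e) * (1 - real Z powr (-e))"
      using eventually_at_right_less[of "0::real"]
    proof eventually_elim
      case (elim e)
      show ?case using step1[OF elim that] by (simp add: algebra_simps)
    qed
  qed
  have "(Gamma has_field_derivative - euler_mascheroni) (at (1::real))"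
  proof -
    have "(Gamma has_field_derivative (Gamma 1 * Digamma 1)) (at (1::real))"
      by (rule has_field_derivative_Gamma) auto
    then show ?thesis by simp
  qed
  then have "((\<lambda>d. (Gamma (1 + d) - 1) / d) \<longlongrightarrow> - euler_mascheroni) (at (0::real))"
    by (simp add: DERIV_def)
  then have "((\<lambda>d. (Gamma (1 + d) - 1) / d) \<longlongrightarrow> - euler_mascheroni) (at_right (0::real))"
    by (rule tendsto_within_subset) simp
  then have "((\<lambda>d. C + (Gamma (1 + d) - 1) / d) \<longlongrightarrow> C + (- euler_mascheroni)) (at_right (0::real))"
    by (rule tendsto_add[OF tendsto_const])
  then have "0 \<le> C + (- euler_mascheroni)"
  proof (rule tendsto_lowerbound)
    show "\<forall>\<^sub>F d in at_right 0. 0 \<le> C + (Gamma (1 + d) - 1) / d"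
      by (rule eventually_mono[OF eventually_at_right_less]) (rule step2)
  qed simp
  then show ?thesis by simp
qed

lemma frequently_mertens_sum_ge:
  fixes h :: real
  assumes "h > 0"
  shows "\<exists>\<^sub>F z in sequentially. mertens_sum z \<ge> euler_mascheroni + ln (ln (real z)) - h"
proof (rule ccontr)
  assume "\<not> ?thesis"
  then have "\<forall>\<^sub>F z in sequentially. mertens_sum z < euler_mascheroni + ln (ln (real z)) - h"
    by (simp add: not_frequently not_le)
  then obtain Z where Z: "\<And>n. n \<ge> Z \<Longrightarrow> mertens_sum n < euler_mascheroni + ln (ln (real n)) - h"
    unfolding eventually_sequentially by blast
  have "euler_mascheroni \<le> euler_mascheroni - h"
  proof (rule euler_mascheroni_le_mertens_bound)
    show "mertens_sum n \<le> euler_mascheroni - h + ln (ln (real n))" if "n \<ge> max Z 3" for n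
      using Z[of n] that by simp
  qed simp
  with assms show False by simp
qed

section \<open>Prime divisors of Mersenne numbers\<close>

lemma dvd_mersenne_iff: "g dvd 2 ^ n - 1 \<longleftrightarrow> ord g 2 dvd n" for g n :: nat
proof -
  have "g dvd 2 ^ n - 1 \<longleftrightarrow> [2 ^ n = 1] (mod g)" by (simp add: cong_altdef_nat)
  then show ?thesis by (simp only: ord_divides)
qed

text \<open>
  Both sides have the same divisors: \<open>x\<close> divides \<open>2^n - 1\<close> exactly when the order of \<open>2\<close> modulo \<open>x\<close>
  divides \<open>n\<close>. For even \<open>x\<close> this is still true because the order is then \<open>0\<close> by convention.
\<close>

lemma gcd_mersenne: "gcd (2 ^ a - 1) (2 ^ b - 1 :: nat) = 2 ^ gcd a b - 1"
proof -
  have "x dvd gcd (2 ^ a - 1) (2 ^ b - 1) \<longleftrightarrow> x dvd 2 ^ gcd a b - 1" for x :: nat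
    by (simp only: gcd_greatest_iff dvd_mersenne_iff)
  from this[of "gcd (2 ^ a - 1) (2 ^ b - 1)"] this[of "2 ^ gcd a b - 1"] show ?thesis
    by (intro dvd_antisym) simp_all
qed

text \<open>
  When \<open>T\<close> is the set of all prime divisors of \<open>d\<close>, the quotient of \<open>2^d - 1\<close> by this number is the
  value at \<open>2\<close> of the \<open>d\<close>-th cyclotomic polynomial. General \<open>T\<close> are allowed for the sake of induction.
\<close>

definition mersenne_lcm :: "nat \<Rightarrow> nat set \<Rightarrow> nat" where
  "mersenne_lcm d T = (LCM q\<in>T. 2 ^ (d div q) - 1)"

text \<open>
  The divisibility lattice is distributive because on exponents of primes it is minimum and maximum.
\<close>

lemma gcd_lcm_distrib_nat: "gcd a (lcm b c) = lcm (gcd a b) (gcd a c :: nat)"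
proof (cases "a = 0 \<or> b = 0 \<or> c = 0")
  case True
  then show ?thesis by (elim disjE) (simp_all add: lcm_proj1_if_dvd_nat lcm_proj2_if_dvd_nat)
next
  case False
  then have "prime_factorization (gcd a (lcm b c)) = prime_factorization (lcm (gcd a b) (gcd a c))"
    by (simp add: prime_factorization_gcd prime_factorization_lcm lcm_eq_0_iff multiset_eq_iff
        inf_min sup_max min_max_distrib2)
  then show ?thesis
    using False by (subst (asm) prime_factorization_unique) (auto simp: lcm_eq_0_iff)
qed

lemma mersenne_lcm_insert:
  "mersenne_lcm d (insert q T) = lcm (2 ^ (d div q) - 1) (mersenne_lcm d T)"
  by (simp add: mersenne_lcm_def)

text \<open>
  The gcd distributes over the lcm, and \<open>gcd (d/q) (d/r) = (d/q)/r\<close> for distinct primes \<open>q\<close>, \<open>r\<close> dividing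
  \<open>d\<close>. As the product of a gcd and an lcm is the product of the two numbers, this gives the recursion
  \<open>G(d, T \<union> {q}) = G(d, T) / G(d/q, T)\<close> for the quotients \<open>G(d, T)\<close> of \<open>2^d - 1\<close> by \<open>mersenne_lcm d T\<close>.
\<close>

lemma gcd_mersenne_lcm:
  assumes "finite T" "\<And>r. r \<in> T \<Longrightarrow> prime r \<and> r dvd d" "prime q" "q dvd d" "q \<notin> T" "d > 0"
  shows "gcd (2 ^ (d div q) - 1) (mersenne_lcm d T) = mersenne_lcm (d div q) T"
  using assms
proof (induction T rule: finite_induct)
  case empty
  then show ?case by (simp add: mersenne_lcm_def)
next
  case (insert r T)
  have "coprime q r" using insert.prems by (metis insertI1 primes_coprime)
  have "q * r dvd d" using insert.prems \<open>coprime q r\<close> by (intro divides_mult) auto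
  then obtain e where e: "d = q * r * e" by blast
  have pos: "q > 0" "r > 0" using insert.prems prime_gt_0_nat by auto
  have "gcd (d div q) (d div r) = d div q div r"
  proof -
    have "gcd (d div q) (d div r) = gcd (r * e) (q * e)"
    proof -
      have "d div q = r * e" "d div r = q * e"
        using e pos by (simp_all add: mult.assoc mult.left_commute[of q r])
      then show ?thesis by simp
    qed
    also have "\<dots> = gcd r q * e" by (simp add: gcd_mult_right gcd.commute)
    also have "\<dots> = e" using \<open>coprime q r\<close> by (simp add: coprime_imp_gcd_eq_1 coprime_commute)
    finally show ?thesis using e pos by (simp add: mult.assoc)
  qed
  then have "gcd (2 ^ (d div q) - 1) (2 ^ (d div r) - 1) = (2 ^ (d div q div r) - 1 :: nat)"
    by (simp only: gcd_mersenne)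
  with insert show ?case by (simp add: mersenne_lcm_insert gcd_lcm_distrib_nat)
qed

lemma mersenne_lcm_pos:
  assumes "finite T" "\<And>r. r \<in> T \<Longrightarrow> prime r \<and> r dvd d" "d > 0"
  shows "mersenne_lcm d T > 0"
proof -
  have "2 ^ (d div q) - 1 \<noteq> (0::nat)" if "q \<in> T" for q
  proof -
    have "d div q > 0" using assms that by (metis dvd_div_eq_0_iff neq0_conv)
    then have "(2::nat) ^ 1 \<le> 2 ^ (d div q)" by (intro power_increasing) auto
    then show ?thesis by simp
  qed
  then have "0 \<notin> (\<lambda>q. 2 ^ (d div q) - 1 :: nat) ` T" by force
  with assms(1) show ?thesis by (simp add: mersenne_lcm_def Lcm_0_iff flip: neq0_conv)
qed

text \<open>
  The recursion for \<open>G\<close> becomes a difference of logarithms, and the main term satisfies the same one: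
  \<open>d (1 - 1/q) = d - d/q\<close>. Hence the error at most doubles with every prime, starting from
  \<open>\<bar>log\<^sub>2 (1 - 2\<^sup>-\<^sup>d)\<bar> \<le> 1\<close>.
\<close>

lemma log_mersenne_quotient_bound:
  assumes "finite T" "\<And>r. r \<in> T \<Longrightarrow> prime r \<and> r dvd d" "d > 0"
  shows "\<bar>log 2 ((2 ^ d - 1) / real (mersenne_lcm d T)) - real d * (\<Prod>q\<in>T. 1 - 1 / real q)\<bar>
           \<le> 2 ^ card T"
  using assms
proof (induction T arbitrary: d rule: finite_induct)
  case empty
  have "(2::real) ^ d / 2 \<le> 2 ^ d - 1"
    using \<open>d > 0\<close> power_increasing[of 1 d "2::real"] by simp
  then have "log 2 (2 ^ d / 2) \<le> log 2 (2 ^ d - 1)" by (intro log_mono) auto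
  moreover have "log 2 (2 ^ d - 1) \<le> log 2 (2 ^ d)"
    using \<open>d > 0\<close> by (intro log_mono) auto
  moreover have "log 2 (2 ^ d / 2) = real d - 1"
    by (subst log_divide) (auto simp: log_nat_power)
  ultimately show ?case
    by (simp add: mersenne_lcm_def log_nat_power)
next
  case (insert q T)
  let ?P = "\<Prod>r\<in>T. 1 - 1 / real r"
  let ?G = "\<lambda>d T. (2 ^ d - 1) / real (mersenne_lcm d T)"
  have q: "prime q" "q dvd d" and T: "\<And>r. r \<in> T \<Longrightarrow> prime r \<and> r dvd d"
    using insert.prems by auto
  obtain e where e: "d = q * e" using q by blast
  have pos: "q > 0" "e > 0" using e \<open>d > 0\<close> by auto
  have dq: "d div q = e" using e pos by simp
  have Te: "prime r \<and> r dvd e" if "r \<in> T" for r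
  proof -
    have "coprime r q" using T[OF that] q insert.hyps that by (metis primes_coprime)
    then show ?thesis using T[OF that] e by (metis coprime_dvd_mult_right_iff)
  qed
  have pow1: "(2::real) ^ n - 1 > 0" if "n > 0" for n using that by simp
  have Lpos: "mersenne_lcm d T > 0" "mersenne_lcm e T > 0"
    using mersenne_lcm_pos[OF insert.hyps(1) T \<open>d > 0\<close>] mersenne_lcm_pos[OF insert.hyps(1) Te \<open>e > 0\<close>]
    by auto
  have "mersenne_lcm d (insert q T) * mersenne_lcm e T = (2 ^ e - 1) * mersenne_lcm d T"
    using gcd_mersenne_lcm[OF insert.hyps(1) T q insert.hyps(2) \<open>d > 0\<close>]
      prod_gcd_lcm_nat[of "2 ^ e - 1" "mersenne_lcm d T"]
    by (simp add: mersenne_lcm_insert dq mult.commute)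
  then have "real (mersenne_lcm d (insert q T) * mersenne_lcm e T) = real ((2 ^ e - 1) * mersenne_lcm d T)"
    by (rule arg_cong)
  then have "real (mersenne_lcm d (insert q T)) * real (mersenne_lcm e T)
      = (2 ^ e - 1) * real (mersenne_lcm d T)"
    by (simp add: of_nat_diff)
  then have "real (mersenne_lcm d (insert q T))
      = (2 ^ e - 1) * real (mersenne_lcm d T) / real (mersenne_lcm e T)"
    using Lpos by (subst nonzero_eq_divide_eq) auto
  then have "?G d (insert q T) = ?G d T / ?G e T" by simp
  then have "log 2 (?G d (insert q T)) = log 2 (?G d T) - log 2 (?G e T)"
    using Lpos pow1[OF pos(2)] pow1[OF \<open>d > 0\<close>] by (simp add: log_divide log_mult)
  moreover have "real d * (\<Prod>r\<in>insert q T. 1 - 1 / real r) = real d * ?P - real e * ?P"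
    using insert.hyps e pos by (simp add: field_simps)
  moreover have "\<bar>log 2 (?G d T) - real d * ?P\<bar> \<le> 2 ^ card T"
    by (rule insert.IH) (use T \<open>d > 0\<close> in auto)
  moreover have "\<bar>log 2 (?G e T) - real e * ?P\<bar> \<le> 2 ^ card T"
    by (rule insert.IH) (use Te \<open>e > 0\<close> in auto)
  moreover have "(2::real) ^ card (insert q T) = 2 * 2 ^ card T" using insert.hyps by simp
  ultimately show ?case by linarith
qed

lemma prime_divisor_mersenne_bound:
  assumes p: "prime p" "p dvd 2 ^ n - 1" and "n > 0"
  shows "log 2 (real p) \<le> real (totient n) + 2 ^ card (prime_factors n)"
proof -
  \<comment> \<open>The prime \<open>p\<close> is primitive for the exponent \<open>d\<close>, hence coprime to the lcm of the smaller numbers.\<close>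
  define d where "d = ord p 2"
  have dvd_iff: "p dvd 2 ^ k - 1 \<longleftrightarrow> d dvd k" for k
    unfolding d_def by (rule dvd_mersenne_iff)
  have "d dvd n" using p dvd_iff by blast
  then have "d > 0" using \<open>n > 0\<close> by (metis dvd_0_left_iff neq0_conv)
  let ?T = "prime_factors d"
  let ?L = "mersenne_lcm d ?T"
  have T: "prime r \<and> r dvd d" if "r \<in> ?T" for r using that by auto
  have Lpos: "?L > 0" by (rule mersenne_lcm_pos) (use T \<open>d > 0\<close> in auto)
  have ndvd: "\<not> p dvd 2 ^ (d div q) - 1" if "q \<in> ?T" for q
  proof -
    have "d div q < d" "d div q > 0"
      using T[OF that] \<open>d > 0\<close> prime_gt_1_nat[of q] dvd_imp_le[of q d]
      by (simp_all add: div_greater_zero_iff)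
    then show ?thesis unfolding dvd_iff by (simp add: nat_dvd_not_less)
  qed
  have "coprime p ?L"
  proof -
    have Lcm: "\<not> p dvd Lcm A" if "finite A" "\<And>a. a \<in> A \<Longrightarrow> \<not> p dvd a" for A :: "nat set"
      using that
    proof (induction A rule: finite_induct)
      case empty
      then show ?case using p by (auto simp: prime_gt_1_nat)
    next
      case (insert a A)
      have "lcm a (Lcm A) dvd a * Lcm A" by (rule lcm_least) auto
      moreover have "\<not> p dvd a * Lcm A"
        using insert p by (simp add: prime_dvd_mult_iff)
      ultimately show ?case using dvd_trans by (simp only: Lcm_insert) blast
    qed
    have "\<not> p dvd ?L"
      unfolding mersenne_lcm_def by (rule Lcm) (use ndvd in blast)+
    then show ?thesis using p by (simp add: prime_imp_coprime)
  qed
  have "?L dvd 2 ^ d - 1"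
  proof -
    have "2 ^ (d div q) - 1 dvd (2 ^ d - 1 :: nat)" if "q \<in> ?T" for q
    proof -
      have "d div q dvd d" using T[OF that] by (metis dvd_div_mult_self dvd_triv_left)
      then have "gcd (2 ^ (d div q) - 1) (2 ^ d - 1 :: nat) = 2 ^ (d div q) - 1"
        by (simp only: gcd_mersenne gcd_nat.absorb1)
      then show ?thesis by (metis gcd_dvd2)
    qed
    then show ?thesis unfolding mersenne_lcm_def by (auto intro: Lcm_least)
  qed
  then obtain g where g: "2 ^ d - 1 = ?L * g" by blast
  have "p dvd ?L * g" using dvd_iff[of d] g by simp
  then have "p dvd g" using \<open>coprime p ?L\<close> by (simp add: coprime_dvd_mult_right_iff)
  have "(2::nat) ^ d - 1 > 0" using \<open>d > 0\<close> power_gt1[of "2::nat" "d - 1"] by simp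
  then have "g > 0" using g by (metis mult_0_right neq0_conv)
  with \<open>p dvd g\<close> have "p \<le> g" by (rule dvd_imp_le)
  have "(2::real) ^ d - 1 = real ?L * real g" using arg_cong[OF g, of real] by (simp add: of_nat_diff)
  then have G: "(2 ^ d - 1) / real ?L = real g" using Lpos by (simp add: field_simps)
  have "log 2 (real p) \<le> log 2 (real g)"
    using \<open>p \<le> g\<close> p by (intro log_mono) (auto simp: prime_gt_0_nat)
  also have "\<dots> \<le> real d * (\<Prod>q\<in>?T. 1 - 1 / real q) + 2 ^ card ?T"
    using log_mersenne_quotient_bound[of ?T d] T \<open>d > 0\<close> unfolding G by auto
  also have "real d * (\<Prod>q\<in>?T. 1 - 1 / real q) = real (totient d)" by (rule totient_formula2[symmetric])
  also have "\<dots> \<le> real (totient n)"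
    using totient_dvd_mono[OF \<open>d dvd n\<close>] \<open>n > 0\<close> by (simp add: dvd_imp_le)
  also have "(2::real) ^ card ?T \<le> 2 ^ card (prime_factors n)"
    using \<open>d dvd n\<close> \<open>n > 0\<close> by (intro power_increasing card_mono dvd_prime_factors) auto
  finally show ?thesis by simp
qed

section \<open>Binary digit sums\<close>

lemma nonzero_bits_0 [simp]: "nonzero_bits 0 = 0"
  by (simp add: nonzero_bits_def)

lemma finite_nonzero_bits: "finite {k. bit (n::nat) k}"
proof (rule finite_subset)
  show "{k. bit n k} \<subseteq> {..<n}"
  proof clarify
    fix k assume "bit n k"
    then have "2 ^ k \<le> n"
      by (metis bit_iff_odd div_less even_zero not_le)
    then show "k < n" by (meson less_exp order_less_le_trans)
  qed
qed auto

lemma nonzero_bits_rec: "nonzero_bits n = n mod 2 + nonzero_bits (n div 2)"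
proof -
  have split: "{k. bit n k} = (if odd n then {0} else {}) \<union> Suc ` {k. bit (n div 2) k}"
  proof (rule Set.set_eqI)
    fix k :: nat
    show "k \<in> {k. bit n k} \<longleftrightarrow> k \<in> (if odd n then {0} else {}) \<union> Suc ` {k. bit (n div 2) k}"
      by (cases k) (auto simp: bit_0 bit_Suc)
  qed
  show ?thesis
    unfolding nonzero_bits_def split
    by (subst card_Un_disjoint)
      (auto simp: finite_nonzero_bits card_image odd_iff_mod_2_eq_one)
qed

lemma nonzero_bits_add_1: "nonzero_bits (n + 1) \<le> nonzero_bits n + 1"
proof (induction n rule: less_induct)
  case (less n)
  show ?case
  proof (cases "even n")
    case True
    then obtain m where "n = 2 * m" by blast
    then show ?thesis
      by (subst nonzero_bits_rec, subst (2) nonzero_bits_rec) simp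
  next
    case False
    then obtain m where m: "n = 2 * m + 1" by (rule oddE)
    then have "nonzero_bits (n + 1) = nonzero_bits (m + 1)" "nonzero_bits n = 1 + nonzero_bits m"
      using nonzero_bits_rec[of "n + 1"] nonzero_bits_rec[of n] by auto
    with less[of m] m show ?thesis by simp
  qed
qed

text \<open>
  Two digits \<open>1\<close> in the lowest place are replaced by a carry, and adding a carry to the sum of the
  higher parts creates at most one non-zero digit.
\<close>

lemma nonzero_bits_add: "nonzero_bits (a + b) \<le> nonzero_bits a + nonzero_bits b"
proof (induction a arbitrary: b rule: less_induct)
  case (less a)
  show ?case
  proof (cases "a = 0")
    case False
    have IH: "nonzero_bits (a div 2 + b div 2) \<le> nonzero_bits (a div 2) + nonzero_bits (b div 2)"
      using False by (intro less) auto
    have carry: "nonzero_bits (a div 2 + b div 2 + 1) \<le> nonzero_bits (a div 2 + b div 2) + 1"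
      by (rule nonzero_bits_add_1)
    consider "even a \<or> even b" | "odd a \<and> odd b" by blast
    then have "nonzero_bits (a + b) \<le> a mod 2 + b mod 2 + nonzero_bits (a div 2 + b div 2)"
    proof cases
      case 1
      then have "(a + b) div 2 = a div 2 + b div 2" "(a + b) mod 2 = a mod 2 + b mod 2"
        by presburger+
      then show ?thesis by (simp only: nonzero_bits_rec[of "a + b"])
    next
      case 2
      then have "(a + b) div 2 = a div 2 + b div 2 + 1" "(a + b) mod 2 = 0"
          "a mod 2 = 1" "b mod 2 = 1"
        by presburger+
      then show ?thesis using carry by (simp only: nonzero_bits_rec[of "a + b"])
    qed
    moreover have "nonzero_bits a = a mod 2 + nonzero_bits (a div 2)"
        "nonzero_bits b = b mod 2 + nonzero_bits (b div 2)"
      by (rule nonzero_bits_rec)+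
    ultimately show ?thesis using IH by linarith
  qed simp
qed

lemma nonzero_bits_sum: "nonzero_bits (\<Sum>i\<in>A. f i) \<le> (\<Sum>i\<in>A. nonzero_bits (f i))"
proof (induction A rule: infinite_finite_induct)
  case (insert x A)
  have "nonzero_bits (\<Sum>i\<in>insert x A. f i) \<le> nonzero_bits (f x) + nonzero_bits (\<Sum>i\<in>A. f i)"
    using insert.hyps nonzero_bits_add by simp
  with insert show ?case by simp
qed auto

lemma nonzero_bits_power2_times [simp]: "nonzero_bits (2 ^ k * a) = nonzero_bits a"
proof (induction k)
  case (Suc k)
  have "nonzero_bits (2 ^ Suc k * a) = nonzero_bits (2 ^ k * a)"
    by (subst nonzero_bits_rec) (simp add: mult.assoc)
  with Suc show ?case by simp
qed simp

lemma nonzero_bits_le_exponent: "a < 2 ^ n \<Longrightarrow> nonzero_bits a \<le> n"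
proof (induction n arbitrary: a)
  case (Suc n)
  then have "nonzero_bits (a div 2) \<le> n" by (intro Suc.IH) auto
  then have "a mod 2 + nonzero_bits (a div 2) \<le> 1 + n" by (intro add_mono) auto
  then show ?case by (subst nonzero_bits_rec) simp
qed simp

lemma nonzero_bits_le_log:
  assumes "a > 0"
  shows "real (nonzero_bits a) \<le> log 2 (real a) + 1"
proof -
  have "a < 2 ^ (floorlog 2 a)" using floorlog_bounds[of a 2] assms by auto
  then have "nonzero_bits a \<le> floorlog 2 a" by (rule nonzero_bits_le_exponent)
  moreover have "real (floorlog 2 a) \<le> log 2 (real a) + 1"
    using assms by (auto simp: floorlog_def)
  ultimately show ?thesis by linarith
qed

lemma power_self_le_exp_times_fact: "real n ^ n \<le> exp (real n) * fact n"
proof -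
  have "real n ^ n /\<^sub>R fact n \<le> (\<Sum>i. real n ^ i /\<^sub>R fact i)"
    using sum_le_suminf[of "\<lambda>i. real n ^ i /\<^sub>R fact i" "{n}"] summable_exp_generic[of "real n"]
    by auto
  then show ?thesis by (simp add: exp_def field_simps)
qed

text \<open>
  Passing from \<open>m\<close> to \<open>m + 1\<close> multiplies the product of the binomial coefficients of order \<open>m\<close> by
  \<open>(m+1)^(m+1) / (m+1)!\<close>, which is at most \<open>e^(m+1)\<close>.
\<close>

lemma sum_ln_binomial_le: "(\<Sum>j\<le>m. ln (real (m choose j))) \<le> real m * (real m + 1) / 2"
proof (induction m)
  case (Suc m)
  have step: "ln (real (Suc m choose j))
      = ln (real (m choose j)) + ln (real (Suc m)) - ln (real (Suc m - j))" if "j \<le> m" for j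
  proof -
    have "(Suc m choose j) * (Suc m - j) = Suc m * (m choose j)"
      using that binomial_absorb_comp[of "Suc m" j] by (simp add: mult.commute)
    then have "real (Suc m choose j) * real (Suc m - j) = real (Suc m) * real (m choose j)"
      by (metis of_nat_mult)
    then have "real (Suc m choose j) = real (Suc m) * real (m choose j) / real (Suc m - j)"
      using that by (simp add: field_simps)
    then show ?thesis using that by (simp add: ln_div ln_mult)
  qed
  have rev: "(\<Sum>j\<le>m. ln (real (Suc m - j))) = ln (fact (Suc m))"
  proof -
    have "(\<Sum>j\<le>m. ln (real (Suc m - j))) = (\<Sum>j\<in>{1..Suc m}. ln (real j))"
      by (rule sum.reindex_bij_witness[of _ "\<lambda>j. Suc m - j" "\<lambda>j. Suc m - j"])
        (auto simp del: of_nat_Suc)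
    also have "\<dots> = ln (\<Prod>j\<in>{1..Suc m}. real j)" by (rule ln_prod[symmetric]) auto
    finally show ?thesis by (simp only: fact_prod of_nat_prod)
  qed
  have "ln (real (Suc m) ^ Suc m) \<le> ln (exp (real (Suc m)) * fact (Suc m))"
    using power_self_le_exp_times_fact[of "Suc m"] by (subst ln_le_cancel_iff) auto
  then have fact: "real (Suc m) * ln (real (Suc m)) \<le> real (Suc m) + ln (fact (Suc m))"
    by (subst (asm) ln_realpow, simp, subst (asm) ln_mult, simp_all)
  have "(\<Sum>j\<le>Suc m. ln (real (Suc m choose j))) = (\<Sum>j\<le>m. ln (real (Suc m choose j)))" by simp
  also have "\<dots> = (\<Sum>j\<le>m. ln (real (m choose j)) + ln (real (Suc m)) - ln (real (Suc m - j)))"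
    by (intro sum.cong refl step) auto
  also have "\<dots> = (\<Sum>j\<le>m. ln (real (m choose j))) + real (Suc m) * ln (real (Suc m)) - ln (fact (Suc m))"
    unfolding sum_subtractf sum.distrib rev by simp
  also have "\<dots> \<le> real m * (real m + 1) / 2 + real (Suc m)"
    using Suc.IH fact by linarith
  finally show ?case by (simp add: field_simps)
qed simp

lemma nonzero_bits_power_le:
  "real (nonzero_bits ((2 ^ k + 1) ^ m)) \<le> real m * (real m + 1) / (2 * ln 2) + real m + 1"
proof -
  have "nonzero_bits ((2 ^ k + 1) ^ m) \<le> (\<Sum>j\<le>m. nonzero_bits (m choose j))"
  proof -
    have "(2 ^ k + 1) ^ m = (\<Sum>j\<le>m. 2 ^ (k * j) * (m choose j))"
      using binomial_ring[of "2 ^ k" "1::nat" m] by (simp add: mult.commute flip: power_mult)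
    then show ?thesis using nonzero_bits_sum[of "\<lambda>j. 2 ^ (k * j) * (m choose j)" "{..m}"] by simp
  qed
  then have "real (nonzero_bits ((2 ^ k + 1) ^ m)) \<le> (\<Sum>j\<le>m. real (nonzero_bits (m choose j)))"
    by (metis of_nat_le_iff of_nat_sum)
  also have "\<dots> \<le> (\<Sum>j\<le>m. log 2 (real (m choose j)) + 1)"
    by (intro sum_mono nonzero_bits_le_log) auto
  also have "\<dots> = (\<Sum>j\<le>m. ln (real (m choose j))) / ln 2 + real m + 1"
    by (simp add: sum.distrib log_def sum_divide_distrib)
  also have "\<dots> \<le> (real m * (real m + 1) / 2) / ln 2 + real m + 1"
    by (intro add_right_mono divide_right_mono sum_ln_binomial_le) auto
  finally show ?thesis by simp
qed

section \<open>Primorials\<close>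

definition primes_upto :: "nat \<Rightarrow> nat set" where
  "primes_upto z = {p \<in> {1..z}. prime p}"

definition primorial :: "nat \<Rightarrow> nat" where
  "primorial z = \<Prod>(primes_upto z)"

lemma finite_primes_upto [simp]: "finite (primes_upto z)"
  by (simp add: primes_upto_def)

lemma prime_factors_primorial: "prime_factors (primorial z) = primes_upto z"
proof -
  have "prime_factors (\<Prod>p\<in>primes_upto z. p) = (\<Union>p\<in>primes_upto z. prime_factors p)"
    by (subst prime_factors_prod) (auto simp: primes_upto_def)
  also have "\<dots> = primes_upto z"
    by (auto simp: primes_upto_def prime_prime_factors)
  finally show ?thesis by (simp add: primorial_def)
qed

lemma totient_primorial_eq_prod: "real (totient (primorial z)) = (\<Prod>p\<in>primes_upto z. real p - 1)"
proof -
  have "real (totient (primorial z)) = (\<Prod>p\<in>primes_upto z. real p * (1 - 1 / real p))"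
    unfolding totient_formula2 prime_factors_primorial
    by (simp add: primorial_def prod.distrib of_nat_prod)
  also have "\<dots> = (\<Prod>p\<in>primes_upto z. real p - 1)"
    by (rule prod.cong) (auto simp: primes_upto_def right_diff_distrib)
  finally show ?thesis .
qed

lemma totient_primorial_eq_exp:
  "real (totient (primorial z)) = real (primorial z) * exp (- mertens_sum z)"
proof -
  have "exp (- mertens_sum z) = (\<Prod>n\<in>{1..z}. exp (- prime_weight n))"
    by (simp add: mertens_sum_def exp_sum flip: sum_negf)
  also have "\<dots> = (\<Prod>p\<in>primes_upto z. exp (- prime_weight p))"
    by (rule prod.mono_neutral_right) (auto simp: primes_upto_def prime_weight_def)
  also have "\<dots> = (\<Prod>p\<in>primes_upto z. 1 - 1 / real p)"
    by (rule prod.cong) (auto simp: primes_upto_def prime_weight_def dest!: prime_gt_1_nat)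
  finally show ?thesis by (simp add: totient_formula2 prime_factors_primorial)
qed

text \<open>
  Each prime from \<open>5\<close> on contributes \<open>p - 1 \<ge> 4\<close>; the first two factors make up for the primes
  \<open>2\<close> and \<open>3\<close>.
\<close>

lemma four_power_card_primes_le:
  assumes "finite P" "\<And>p. p \<in> P \<Longrightarrow> prime p"
  shows "4 ^ card P \<le> (if 2 \<in> P then 4 else 1) * (if 3 \<in> P then 2 else 1) * (\<Prod>p\<in>P. real p - 1)"
  using assms
proof (induction P rule: finite_induct)
  case (insert p P)
  let ?c = "(if 2 \<in> P then 4 else 1) * (if 3 \<in> P then 2 else 1) :: real"
  let ?c' = "(if 2 \<in> insert p P then 4 else 1) * (if 3 \<in> insert p P then 2 else 1) :: real"
  have p: "prime p" "p \<noteq> 4" "p \<ge> 2"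
    using insert.prems[of p] prime_ge_2_nat[of p] prime_nat_not_dvd[of p 2] by auto
  have nonneg: "(\<Prod>p\<in>P. real p - 1) \<ge> 0"
    using insert.prems prime_ge_1_nat by (intro prod_nonneg) force
  consider "p = 2" | "p = 3" | "p \<ge> 5" using p by linarith
  then have "4 * ?c \<le> ?c' * (real p - 1)"
    using insert.hyps by cases auto
  then have "4 * ?c * (\<Prod>p\<in>P. real p - 1) \<le> ?c' * (real p - 1) * (\<Prod>p\<in>P. real p - 1)"
    using nonneg by (rule mult_right_mono)
  moreover have "4 ^ card P \<le> ?c * (\<Prod>p\<in>P. real p - 1)"
    using insert by simp
  ultimately show ?case using insert.hyps by (simp add: mult.assoc)
qed simp

text \<open>
  In the form \<open>2^\<omega> \<le> (8 / 2^\<omega>) \<phi>(K)\<close> this makes the error term of the bound for prime divisors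
  negligible, as \<open>\<omega> \<rightarrow> \<infinity>\<close>.
\<close>

lemma two_power_card_primes_le:
  "2 ^ card (primes_upto z) * 2 ^ card (primes_upto z) \<le> 8 * real (totient (primorial z))"
proof -
  let ?P = "primes_upto z"
  have "(2::real) ^ card ?P * 2 ^ card ?P = 4 ^ card ?P" by (simp flip: power_mult_distrib)
  also have "\<dots> \<le> (if 2 \<in> ?P then 4 else 1) * (if 3 \<in> ?P then 2 else 1) * real (totient (primorial z))"
    unfolding totient_primorial_eq_prod
    by (rule four_power_card_primes_le) (auto simp: primes_upto_def)
  also have "\<dots> \<le> 8 * real (totient (primorial z))"
    by (intro mult_right_mono) auto
  finally show ?thesis .
qed

lemma two_power_card_primes_le_primorial: "2 ^ card (primes_upto z) \<le> primorial z"
proof -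
  have "(\<Prod>p\<in>primes_upto z. 2) \<le> (\<Prod>p\<in>primes_upto z. p)"
    by (intro prod_mono) (auto simp: primes_upto_def prime_ge_2_nat)
  then show ?thesis by (simp add: primorial_def)
qed

lemma primorial_le_power: "primorial z \<le> z ^ z"
proof (cases "z = 0")
  case False
  have "primorial z \<le> (\<Prod>p\<in>primes_upto z. z)"
    unfolding primorial_def by (intro prod_mono) (auto simp: primes_upto_def)
  also have "\<dots> = z ^ card (primes_upto z)" by simp
  also have "\<dots> \<le> z ^ z"
  proof (rule power_increasing)
    show "card (primes_upto z) \<le> z"
    proof -
      have "card (primes_upto z) \<le> card {1..z}"
        by (rule card_mono) (auto simp: primes_upto_def)
      then show ?thesis by simp
    qed
  qed (use False in auto)
  finally show ?thesis .
qed (simp add: primorial_def primes_upto_def)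

lemma even_primorial: "z \<ge> 2 \<Longrightarrow> even (primorial z)"
  unfolding primorial_def
  by (rule dvd_trans[OF _ dvd_prodI[of _ 2]]) (auto simp: primes_upto_def)

lemma filterlim_card_primes_upto: "filterlim (\<lambda>z. card (primes_upto z)) at_top sequentially"
  unfolding filterlim_at_top
proof
  fix B :: nat
  have "infinite {p::nat. prime p}" by (rule primes_infinite)
  then obtain P where P: "finite P" "card P = B" "P \<subseteq> {p::nat. prime p}"
    using infinite_arbitrarily_large by blast
  obtain Z where Z: "P \<subseteq> {..Z}" using P(1) finite_nat_iff_bounded_le by blast
  have "B \<le> card (primes_upto z)" if "z \<ge> Z" for z
  proof -
    have "P \<subseteq> primes_upto z" using P Z that by (auto simp: primes_upto_def prime_ge_1_nat[simplified])
    then show ?thesis using P card_mono[OF finite_primes_upto] by blast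
  qed
  then show "\<forall>\<^sub>F z in sequentially. B \<le> card (primes_upto z)"
    unfolding eventually_sequentially by blast
qed

section \<open>Powers of \<open>2^k + 1\<close>\<close>

text \<open>
  The exponent \<open>m\<close> is the largest one with \<open>m\<^sup>2/(2 ln 2) \<le> \<alpha> km\<close>, where \<open>km\<close> is a lower bound for the
  number of digits; the remaining terms are linear in \<open>m = O(\<surd>n)\<close>.
\<close>

lemma power_two_plus_one_bits:
  fixes \<alpha> :: real
  assumes \<alpha>: "0 < \<alpha>" "\<alpha> < 1" and m: "m = nat \<lfloor>2 * \<alpha> * real k * ln 2\<rfloor>" and "m \<ge> 1" "k \<ge> 3"
  defines "N \<equiv> (2 ^ k + 1) ^ m"
  shows "real (nonzero_bits N) \<le> \<alpha> * real (num_bits N)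
           + 6 * (real (num_bits N) powr (1/2) * ln (real (num_bits N)))"
proof -
  define n where "n = real (num_bits N)"
  have ln2: "ln 2 \<ge> (1/2::real)" "ln 2 \<le> (1::real)"
    using ln2_ge_two_thirds ln_le_minus_one[of "2::real"] by linarith+
  have m_le: "real m \<le> 2 * \<alpha> * real k * ln 2"
    unfolding m using \<alpha> by (intro of_nat_floor mult_nonneg_nonneg) auto
  have "(2 ^ k) ^ m \<le> N" unfolding N_def by (intro power_mono) auto
  then have "2 ^ (k * m) \<le> N" by (simp add: power_mult)
  then have "Suc (k * m) \<le> num_bits N"
    unfolding num_bits_def by (rule floorlog_ge_SucI) simp
  then have "real (k * m) \<le> n" unfolding n_def by linarith
  then have km: "real k * real m \<le> n" by simp
  have "3 * 1 \<le> real k * real m" using \<open>k \<ge> 3\<close> \<open>m \<ge> 1\<close> by (intro mult_mono) auto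
  with km have n3: "n \<ge> 3" by simp
  have "real m * real m \<le> (2 * \<alpha> * real k * ln 2) * real m"
    using m_le by (intro mult_right_mono) auto
  also have "\<dots> = 2 * ln 2 * (\<alpha> * (real k * real m))" by simp
  also have "\<dots> \<le> 2 * ln 2 * (\<alpha> * n)" using km assms by (intro mult_left_mono) auto
  finally have mm: "real m * real m \<le> 2 * ln 2 * (\<alpha> * n)" .
  have "real m \<le> 2 * sqrt n"
  proof -
    have "2 * ln 2 * (\<alpha> * n) \<le> 2 * 1 * (1 * n)"
      using ln2 assms n3 by (intro mult_mono) auto
    with mm have "real m * real m \<le> 2 * 1 * (1 * n)" by linarith
    then have "(real m)\<^sup>2 \<le> 4 * n" using n3 by (simp add: power2_eq_square)
    then have "real m \<le> sqrt (4 * n)" by (rule real_le_rsqrt)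
    then show ?thesis by (simp add: real_sqrt_mult)
  qed
  have "real (nonzero_bits N) \<le> real m * (real m + 1) / (2 * ln 2) + real m + 1"
    unfolding N_def by (rule nonzero_bits_power_le)
  also have "real m * (real m + 1) / (2 * ln 2) = real m * real m / (2 * ln 2) + real m / (2 * ln 2)"
    by (simp add: distrib_left add_divide_distrib)
  also have "real m * real m / (2 * ln 2) \<le> \<alpha> * n"
    using mm ln2 by (simp add: field_simps)
  also have "real m / (2 * ln 2) \<le> real m"
    using ln2 mult_left_mono[of 1 "2 * ln 2" "real m"] by (simp add: field_simps)
  finally have "real (nonzero_bits N) \<le> \<alpha> * n + 3 * real m" using \<open>m \<ge> 1\<close> by simp
  also have "3 * real m \<le> 6 * (sqrt n * 1)" using \<open>real m \<le> 2 * sqrt n\<close> by simp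
  also have "\<dots> \<le> 6 * (sqrt n * ln n)"
  proof -
    have "exp 1 \<le> n" using n3 exp_le by linarith
    then have "1 \<le> ln n" using n3 by (simp add: ln_ge_iff)
    then show ?thesis using n3 by (intro mult_left_mono) auto
  qed
  also have "sqrt n = n powr (1/2)" using n3 by (simp add: powr_half_sqrt)
  finally show ?thesis by (simp add: n_def)
qed

text \<open>
  The lower bound has the true order of magnitude, since it controls the smoothness level. The upper bound
  only enters through a triple logarithm and can be crude.
\<close>

lemma ln_power_two_plus_one_bounds:
  fixes \<alpha> :: real
  assumes \<alpha>: "0 < \<alpha>" "\<alpha> < 1" and m: "m = nat \<lfloor>2 * \<alpha> * real k * ln 2\<rfloor>" and "k \<ge> 3"
  defines "N \<equiv> (2 ^ k + 1) ^ m :: nat"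
  shows "2 * \<alpha> * (real k * ln 2)\<^sup>2 - real k * ln 2 \<le> ln (real N)" "ln (real N) \<le> real k ^ 3"
proof -
  have ln2: "ln 2 > (0::real)" "ln 2 \<le> (1::real)"
    using ln_le_minus_one[of "2::real"] by auto
  have "real N = (2 ^ k + 1) ^ m" by (simp add: N_def add.commute)
  then have lnN: "ln (real N) = real m * ln (2 ^ k + 1)"
    by (simp add: ln_realpow add_pos_pos)
  have m_le: "real m \<le> 2 * \<alpha> * real k * ln 2"
    unfolding m using \<alpha> by (intro of_nat_floor mult_nonneg_nonneg) auto
  have m_ge: "real m \<ge> 2 * \<alpha> * real k * ln 2 - 1" using m assms by linarith
  have "2 * \<alpha> * (real k * ln 2)\<^sup>2 - real k * ln 2 = (2 * \<alpha> * real k * ln 2 - 1) * (real k * ln 2)"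
    by (simp add: power2_eq_square algebra_simps)
  also have "\<dots> \<le> real m * (real k * ln 2)" using m_ge by (intro mult_right_mono) auto
  also have "\<dots> = real m * ln (2 ^ k)" by (simp add: ln_realpow)
  also have "\<dots> \<le> ln (real N)" unfolding lnN by (intro mult_left_mono) (auto simp: add_pos_pos)
  finally show "2 * \<alpha> * (real k * ln 2)\<^sup>2 - real k * ln 2 \<le> ln (real N)" .
  have "ln (2 ^ k + 1) \<le> ln ((2::real) ^ (k + 1))"
    by (subst ln_le_cancel_iff) (auto simp: add_pos_pos)
  also have "\<dots> = (real k + 1) * ln 2" by (subst ln_realpow) simp_all
  also have "\<dots> \<le> (real k + 1) * 1" using ln2 by (intro mult_left_mono) auto
  finally have b: "ln (2 ^ k + 1) \<le> real k + 1" by simp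
  have "2 * \<alpha> * real k * ln 2 \<le> 2 * 1 * real k * 1"
    using assms ln2 by (intro mult_mono) auto
  with m_le have "real m \<le> 2 * real k" by simp
  then have "ln (real N) \<le> (2 * real k) * (real k + 1)"
    unfolding lnN using b by (intro mult_mono) (auto simp: add_pos_pos)
  also have "\<dots> = real k * (2 * real k + 2)" by (simp add: algebra_simps)
  also have "\<dots> \<le> real k * (real k * real k)"
  proof (intro mult_left_mono)
    have "3 * real k \<le> real k * real k" using assms by (intro mult_right_mono) auto
    then show "2 * real k + 2 \<le> real k * real k" using \<open>k \<ge> 3\<close> by linarith
  qed auto
  finally show "ln (real N) \<le> real k ^ 3" by (simp add: power3_eq_cube)
qed

lemma prime_divisor_power_two_plus_one:
  assumes "prime p" "p dvd (2 ^ k + 1) ^ m" "k > 0"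
  shows "ln (real p) \<le> ln 2 * (real (totient (2 * k)) + 2 ^ card (prime_factors (2 * k)))"
proof -
  have "p dvd 2 ^ k + 1" using assms prime_dvd_power by blast
  then have "p dvd (2 ^ k + 1) * (2 ^ k - 1)" by (rule dvd_mult2)
  also have "(2 ^ k + 1) * (2 ^ k - 1) = (2 ^ (2 * k) - 1 :: nat)"
  proof -
    have "(a + 1) * (a - 1) = a * a - 1" for a :: nat by (cases a) auto
    then show ?thesis by (simp add: mult_2 power_add)
  qed
  finally have "log 2 (real p) \<le> real (totient (2 * k)) + 2 ^ card (prime_factors (2 * k))"
    using assms by (intro prime_divisor_mersenne_bound) auto
  then show ?thesis by (simp add: log_def field_simps)
qed

text \<open>
  The comparison of the bound for \<open>ln p\<close> with the logarithm of the smoothness level. Here \<open>x\<close> stands for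
  \<open>k\<close>, \<open>L\<close> for \<open>ln z\<close>, \<open>\<phi>\<close> for \<open>\<phi>(2k)\<close>, and every asymptotic relation holds up to a factor
  governed by the same small \<open>h\<close>; the hypothesis \<open>slack\<close> says that these losses fit into \<open>1 + \<eta>\<close>.
\<close>

lemma smooth_level_powr_ge:
  fixes \<alpha> \<eta> h x L \<phi> A :: real
  assumes "0 < \<alpha>" "0 < h" "h < 1" and slack: "(1 + h)\<^sup>2 * exp h \<le> (1 + \<eta>) * sqrt (1 - h)"
    and "x > 0" "L > 0"
    and \<phi>: "\<phi> \<le> 2 * x * exp (- euler_mascheroni + h) / L"
    and A: "A \<le> ln 2 * ((1 + h) * \<phi>)"
    and lower: "2 * \<alpha> * (x * ln 2)\<^sup>2 * (1 - h) \<le> ln (real N)"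
    and lll: "0 < ln (ln (ln (real N)))" "ln (ln (ln (real N))) \<le> (1 + h) * L"
  shows "exp A \<le> smooth_level \<alpha> N powr (1 + \<eta>)"
proof -
  let ?l = "ln (ln (ln (real N)))" and ?g = "exp (- euler_mascheroni) :: real"
  have lnN: "ln (real N) \<ge> 0"
    using lower assms by (intro order.trans[OF _ lower] mult_nonneg_nonneg) auto
  have "(2 * (x * ln 2) * sqrt (1 - h))\<^sup>2 \<le> 2 / \<alpha> * ln (real N)"
    using lower assms by (simp add: power_mult_distrib field_simps)
  then have S: "2 * (x * ln 2) * sqrt (1 - h) \<le> sqrt (2 / \<alpha> * ln (real N))"
    by (rule real_le_rsqrt)
  \<comment> \<open>The right-hand side of \<open>slack\<close> cannot be negative.\<close>
  have eta: "1 + \<eta> \<ge> 0"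
  proof (rule ccontr)
    assume "\<not> 0 \<le> 1 + \<eta>"
    then have "(1 + \<eta>) * sqrt (1 - h) \<le> 0" using assms by (intro mult_nonpos_nonneg) auto
    moreover have "(1 + h)\<^sup>2 * exp h > 0" using assms by (intro mult_pos_pos) auto
    ultimately show False using slack by linarith
  qed
  have "A \<le> ln 2 * ((1 + h) * (2 * x * (?g * exp h) / L))"
  proof -
    have "ln 2 * ((1 + h) * \<phi>) \<le> ln 2 * ((1 + h) * (2 * x * exp (- euler_mascheroni + h) / L))"
      using \<phi> assms by (intro mult_left_mono) auto
    then show ?thesis using A by (simp add: exp_add[symmetric])
  qed
  also have "\<dots> = (1 + h)\<^sup>2 * exp h * (?g * (2 * (x * ln 2)) / ((1 + h) * L))"
    using assms by (simp add: power2_eq_square field_simps)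
  also have "\<dots> \<le> (1 + \<eta>) * sqrt (1 - h) * (?g * (2 * (x * ln 2)) / ((1 + h) * L))"
    using assms slack by (intro mult_right_mono) auto
  also have "\<dots> = (1 + \<eta>) * (?g * (2 * (x * ln 2) * sqrt (1 - h)) / ((1 + h) * L))"
    by simp
  also have "\<dots> \<le> (1 + \<eta>) * (?g * sqrt (2 / \<alpha> * ln (real N)) / ?l)"
    using S eta lll assms lnN by (intro mult_left_mono frac_le) auto
  also have "?g * sqrt (2 / \<alpha> * ln (real N)) / ?l
      = 2 powr (1/2) * ?g * \<alpha> powr (- 1/2) * ln (real N) powr (1/2) * inverse ?l"
  proof -
    have "\<alpha> powr (- 1/2) = 1 / sqrt \<alpha>"
      using assms powr_minus_divide[of \<alpha> "1/2"] by (simp add: powr_half_sqrt)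
    then show ?thesis
      using assms lnN by (simp add: powr_half_sqrt real_sqrt_mult real_sqrt_divide field_simps)
  qed
  finally have "A \<le> (1 + \<eta>) * ln (smooth_level \<alpha> N)" by (simp add: smooth_level_def)
  then show ?thesis by (simp add: powr_def smooth_level_def)
qed

lemma exists_sparse_smooth:
  fixes \<alpha> \<eta> :: real
  assumes \<alpha>: "0 < \<alpha>" "\<alpha> < 1" and "\<eta> > 0"
  shows "\<exists>N\<ge>B. N \<ge> 1 \<and> smooth (smooth_level \<alpha> N powr (1 + \<eta>)) N \<and>
           real (nonzero_bits N) \<le> \<alpha> * real (num_bits N)
             + 6 * (real (num_bits N) powr (1/2) * ln (real (num_bits N)))"
proof -
  \<comment> \<open>Fix the tolerance \<open>h\<close>; all remaining conditions hold for large \<open>z\<close>, except the lower bound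
      for Mertens' sum, which holds infinitely often.\<close>
  have "\<forall>\<^sub>F h in at_right 0. (1 + h)\<^sup>2 * exp h < (1 + \<eta>) * sqrt (1 - h)"
    using \<open>\<eta> > 0\<close> by real_asymp
  moreover have "\<forall>\<^sub>F h in at_right 0. h < (1::real)" by real_asymp
  moreover have "\<forall>\<^sub>F h in at_right 0. h > (0::real)" by (rule eventually_at_right_less)
  ultimately have "\<forall>\<^sub>F h::real in at_right 0. (1 + h)\<^sup>2 * exp h < (1 + \<eta>) * sqrt (1 - h) \<and> h < 1 \<and> h > 0"
    by eventually_elim auto
  then obtain h :: real where h: "(1 + h)\<^sup>2 * exp h < (1 + \<eta>) * sqrt (1 - h)" "h < 1" "h > 0"
    using eventually_happens'[OF trivial_limit_at_right_real] by blast
  define k where "k z = primorial z div 2" for z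
  have K: "primorial z = 2 * k z" if "z \<ge> 2" for z
    using even_primorial[OF that] by (simp add: k_def)
  have card: "filterlim (\<lambda>z. 2 ^ card (primes_upto z) :: real) at_top sequentially"
    by (rule filterlim_compose[OF _ filterlim_card_primes_upto]) real_asymp
  have k_top: "filterlim (\<lambda>z. real (k z)) at_top sequentially"
  proof (rule filterlim_at_top_mono)
    show "filterlim (\<lambda>z. (1/2) * 2 ^ card (primes_upto z) :: real) at_top sequentially"
      by (rule filterlim_tendsto_pos_mult_at_top[OF tendsto_const _ card]) simp
    show "\<forall>\<^sub>F z in sequentially. (1/2) * 2 ^ card (primes_upto z) \<le> real (k z)"
      using eventually_ge_at_top[of 2]
    proof eventually_elim
      case (elim z)
      have "real (2 ^ card (primes_upto z)) \<le> real (primorial z)"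
        by (subst of_nat_le_iff) (rule two_power_card_primes_le_primorial)
      then show ?case using K[OF elim] by simp
    qed
  qed
  \<comment> \<open>A lower bound for \<open>ln N\<close>: the \<open>4\<close> exceeds \<open>e\<close> and makes the triple logarithm positive,
      while \<open>ln N \<ge> B\<close> forces \<open>N \<ge> B\<close>.\<close>
  define M where "M = max 4 (real B)"
  have "\<forall>\<^sub>F z in sequentially. 8 / h \<le> 2 ^ card (primes_upto z)"
    using card by (simp add: filterlim_at_top)
  moreover have "\<forall>\<^sub>F x in at_top. x \<ge> 3 \<and> x * ln 2 \<le> h * (2 * \<alpha> * (x * ln 2)\<^sup>2)
      \<and> M \<le> 2 * \<alpha> * (x * ln 2)\<^sup>2 * (1 - h)"
  proof (intro eventually_conj eventually_ge_at_top)
    show "\<forall>\<^sub>F x in at_top. x * ln 2 \<le> h * (2 * \<alpha> * (x * ln 2)\<^sup>2)" using h \<alpha> by real_asymp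
    have "1 - h > 0" using h by simp
    then show "\<forall>\<^sub>F x in at_top. M \<le> 2 * \<alpha> * (x * ln 2)\<^sup>2 * (1 - h)" using \<alpha> by real_asymp
  qed
  then have "\<forall>\<^sub>F z in sequentially. real (k z) \<ge> 3
      \<and> real (k z) * ln 2 \<le> h * (2 * \<alpha> * (real (k z) * ln 2)\<^sup>2)
      \<and> M \<le> 2 * \<alpha> * (real (k z) * ln 2)\<^sup>2 * (1 - h)"
    by (rule eventually_compose_filterlim[OF _ k_top])
  moreover have "\<forall>\<^sub>F z in sequentially. ln 3 + ln (real z) + ln (ln (real z)) \<le> (1 + h) * ln (real z)"
    using h by real_asymp
  moreover have "\<forall>\<^sub>F z::nat in sequentially. z \<ge> 3" by (rule eventually_ge_at_top)
  ultimately have "\<forall>\<^sub>F z in sequentially. 8 / h \<le> 2 ^ card (primes_upto z)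
      \<and> (real (k z) \<ge> 3 \<and> real (k z) * ln 2 \<le> h * (2 * \<alpha> * (real (k z) * ln 2)\<^sup>2)
         \<and> M \<le> 2 * \<alpha> * (real (k z) * ln 2)\<^sup>2 * (1 - h))
      \<and> ln 3 + ln (real z) + ln (ln (real z)) \<le> (1 + h) * ln (real z) \<and> z \<ge> 3"
    by eventually_elim blast
  from frequently_ex[OF frequently_eventually_conj[OF frequently_mertens_sum_ge[OF \<open>h > 0\<close>] this]]
  obtain z where z: "8 / h \<le> 2 ^ card (primes_upto z)" "real (k z) \<ge> 3"
      "real (k z) * ln 2 \<le> h * (2 * \<alpha> * (real (k z) * ln 2)\<^sup>2)"
      "M \<le> 2 * \<alpha> * (real (k z) * ln 2)\<^sup>2 * (1 - h)"
      "ln 3 + ln (real z) + ln (ln (real z)) \<le> (1 + h) * ln (real z)" "z \<ge> 3"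
      "mertens_sum z \<ge> euler_mascheroni + ln (ln (real z)) - h" by blast
  define x where "x = real (k z)"
  define m where "m = nat \<lfloor>2 * \<alpha> * real (k z) * ln 2\<rfloor>"
  define N where "N = (2 ^ k z + 1 :: nat) ^ m"
  have k3: "k z \<ge> 3" using z(2) by simp
  have lnN: "2 * \<alpha> * (x * ln 2)\<^sup>2 - x * ln 2 \<le> ln (real N)" "ln (real N) \<le> x ^ 3"
    using ln_power_two_plus_one_bounds[OF \<alpha> m_def k3] by (simp_all add: x_def N_def)
  have lower: "2 * \<alpha> * (x * ln 2)\<^sup>2 * (1 - h) \<le> ln (real N)"
    using lnN(1) z(3) unfolding x_def[symmetric] by (simp add: algebra_simps)
  then have M: "M \<le> ln (real N)" using z(4) unfolding x_def by linarith
  have "N \<ge> 1" by (simp add: N_def)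
  have "real B \<le> ln (real N)" "4 \<le> ln (real N)" using M by (simp_all add: M_def)
  then have "real B \<le> real N" using ln_le_minus_one[of "real N"] \<open>N \<ge> 1\<close> by simp
  then have "B \<le> N" by simp
  have "m \<ge> 1"
  proof (rule ccontr)
    assume "\<not> m \<ge> 1"
    then have "N = 1" by (simp add: N_def)
    with \<open>4 \<le> ln (real N)\<close> show False by simp
  qed
  have lnz: "ln (real z) > 1"
  proof -
    have "exp 1 < real z" using z(6) e_less_272 by linarith
    then have "ln (exp 1) < ln (real z)" by (subst ln_less_cancel_iff) (use z(6) in auto)
    then show ?thesis by simp
  qed
  have lll: "0 < ln (ln (ln (real N)))" "ln (ln (ln (real N))) \<le> (1 + h) * ln (real z)"
  proof -
    have "exp 1 < ln (real N)" using \<open>4 \<le> ln (real N)\<close> exp_le by linarith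
    then have "ln (exp 1) < ln (ln (real N))"
      by (subst ln_less_cancel_iff) (use \<open>4 \<le> ln (real N)\<close> in auto)
    then have l2: "1 < ln (ln (real N))" by simp
    then show "0 < ln (ln (ln (real N)))" by simp
    have x3: "x \<ge> 3" using z(2) by (simp add: x_def)
    have "ln (ln (real N)) \<le> ln (x ^ 3)"
      using lnN(2) \<open>4 \<le> ln (real N)\<close> by (intro ln_mono) auto
    also have "\<dots> = 3 * ln x" using x3 by (simp add: ln_realpow)
    finally have "ln (ln (real N)) \<le> 3 * ln x" .
    moreover have "ln x \<le> real z * ln (real z)"
    proof -
      have "k z \<le> z ^ z" using primorial_le_power[of z] by (simp add: k_def)
      then have "x \<le> real z ^ z" unfolding x_def by (metis of_nat_le_iff of_nat_power)
      then have "ln x \<le> ln (real z ^ z)" using x3 by (intro ln_mono) auto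
      then show ?thesis using z(6) by (simp add: ln_realpow)
    qed
    ultimately have "ln (ln (ln (real N))) \<le> ln (3 * (real z * ln (real z)))"
      using l2 by (intro ln_mono) auto
    also have "\<dots> = ln 3 + ln (real z) + ln (ln (real z))"
      using z(6) lnz by (simp add: ln_mult)
    finally show "ln (ln (ln (real N))) \<le> (1 + h) * ln (real z)" using z(5) by linarith
  qed
  have K2: "primorial z = 2 * k z" using z(6) by (intro K) simp
  define \<phi> where "\<phi> = real (totient (primorial z))"
  have phi: "\<phi> \<le> 2 * x * exp (- euler_mascheroni + h) / ln (real z)"
  proof -
    have "exp (- mertens_sum z) \<le> exp (- euler_mascheroni + h - ln (ln (real z)))"
      using z(7) by simp
    also have "\<dots> = exp (- euler_mascheroni + h) / ln (real z)"
      using lnz by (simp add: exp_diff)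
    finally have "2 * x * exp (- mertens_sum z) \<le> 2 * x * (exp (- euler_mascheroni + h) / ln (real z))"
      using z(2) by (intro mult_left_mono) (auto simp: x_def)
    moreover have "\<phi> = real (primorial z) * exp (- mertens_sum z)"
      unfolding \<phi>_def by (rule totient_primorial_eq_exp)
    moreover have "real (primorial z) = 2 * x" by (simp add: K2 x_def)
    ultimately show ?thesis by simp
  qed
  have omega: "2 ^ card (primes_upto z) \<le> h * \<phi>"
  proof -
    let ?w = "2 ^ card (primes_upto z) :: real"
    have "8 / h * ?w \<le> ?w * ?w" using z(1) by (intro mult_right_mono) auto
    also have "\<dots> \<le> 8 * \<phi>" unfolding \<phi>_def by (rule two_power_card_primes_le)
    finally show ?thesis using h by (simp add: field_simps)
  qed
  have "smooth (smooth_level \<alpha> N powr (1 + \<eta>)) N"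
    unfolding smooth_def
  proof (intro conjI notI)
    assume "\<exists>p. prime p \<and> p dvd N \<and> real p > smooth_level \<alpha> N powr (1 + \<eta>)"
    then obtain p where p: "prime p" "p dvd N" "real p > smooth_level \<alpha> N powr (1 + \<eta>)" by blast
    have "ln (real p) \<le> ln 2 * (\<phi> + 2 ^ card (primes_upto z))"
      using prime_divisor_power_two_plus_one[of p "k z" m] p k3
      by (simp add: N_def \<phi>_def K2 flip: prime_factors_primorial)
    also have "\<dots> \<le> ln 2 * ((1 + h) * \<phi>)" using omega by (intro mult_left_mono) (auto simp: algebra_simps)
    finally have "exp (ln (real p)) \<le> smooth_level \<alpha> N powr (1 + \<eta>)"
      using h z(2) lnz lower lll phi \<alpha>
      by (intro smooth_level_powr_ge[where h = h and x = x and L = "ln (real z)" and \<phi> = \<phi>])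
        (auto simp: x_def)
    with p show False by (simp add: prime_gt_0_nat)
  qed (use \<open>N \<ge> 1\<close> in simp)
  moreover have "real (nonzero_bits N) \<le> \<alpha> * real (num_bits N)
             + 6 * (real (num_bits N) powr (1/2) * ln (real (num_bits N)))"
    unfolding N_def by (rule power_two_plus_one_bits[OF \<alpha> m_def \<open>m \<ge> 1\<close> k3])
  ultimately show ?thesis using \<open>B \<le> N\<close> \<open>N \<ge> 1\<close> by blast
qed

text \<open>
  A strictly increasing sequence of witnesses for \<open>\<eta> = 1, 1/2, 1/3, \<dots>\<close>; the function \<open>\<epsilon>\<close> reads the
  index of the witness off its value.
\<close>

lemma diagonal_sequence:
  fixes P :: "real \<Rightarrow> nat \<Rightarrow> bool"
  assumes "\<And>\<eta> B. \<eta> > 0 \<Longrightarrow> \<exists>N\<ge>B. P \<eta> N"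
  shows "\<exists>(S :: nat set) \<epsilon>. infinite S \<and> (\<epsilon> \<longlongrightarrow> 0) (inf at_top (principal S)) \<and> (\<forall>N\<in>S. P (\<epsilon> N) N)"
proof -
  have "\<exists>f. \<forall>i. P (1 / real (Suc i)) (f i) \<and> f i < f (Suc i)"
  proof (rule dependent_nat_choice)
    show "\<exists>N. P (1 / real (Suc 0)) N" using assms[of "1 / real (Suc 0)" 0] by auto
    show "\<exists>N'. P (1 / real (Suc (Suc i))) N' \<and> N < N'" for N i
      using assms[of "1 / real (Suc (Suc i))" "Suc N"] by (auto simp: Suc_le_eq)
  qed
  then obtain f where f: "\<And>i. P (1 / real (Suc i)) (f i)" "strict_mono f"
    by (auto simp: strict_mono_Suc_iff)
  define \<epsilon> where "\<epsilon> N = 1 / real (Suc (inv_into UNIV f N))" for N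
  have inj: "inj f" using f(2) by (rule strict_mono_imp_inj_on)
  then have eps: "\<epsilon> (f i) = 1 / real (Suc i)" for i by (simp add: \<epsilon>_def)
  have "infinite (range f)" using inj by (rule range_inj_infinite)
  moreover have "(\<epsilon> \<longlongrightarrow> 0) (inf at_top (principal (range f)))"
  proof (rule tendstoI)
    fix e :: real assume "e > 0"
    then obtain i where i: "1 / real (Suc i) < e" using nat_approx_posE by blast
    have close: "dist (\<epsilon> N) 0 < e" if "N \<ge> f i" "N \<in> range f" for N
    proof -
      obtain j where j: "N = f j" using \<open>N \<in> range f\<close> by blast
      then have "i \<le> j" using \<open>N \<ge> f i\<close> strict_mono_less_eq[OF f(2)] by simp
      then have "1 / real (Suc j) \<le> 1 / real (Suc i)" by (intro divide_left_mono) auto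
      with i show ?thesis by (simp add: j eps)
    qed
    then show "\<forall>\<^sub>F N in inf at_top (principal (range f)). dist (\<epsilon> N) 0 < e"
      unfolding eventually_inf_principal
      by (intro eventually_mono[OF eventually_ge_at_top[of "f i"]] impI close)
  qed
  moreover have "\<forall>N\<in>range f. P (\<epsilon> N) N" using f(1) eps by auto
  ultimately show ?thesis by blast
qed

theorem theorem1p2:
  shows "\<exists>c::real. c > 0 \<and>
    (\<forall>\<alpha>::real. 0 < \<alpha> \<and> \<alpha> < 1 \<longrightarrow>
      (\<exists>(S :: nat set) (\<epsilon> :: nat \<Rightarrow> real) (E :: nat \<Rightarrow> real).
         infinite S \<and>
         (\<epsilon> \<longlongrightarrow> 0) (inf at_top (principal S)) \<and>
         (\<forall>N\<in>S. N \<ge> 1 \<and>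
            smooth (smooth_level \<alpha> N powr (1 + \<epsilon> N)) N \<and>
            real (nonzero_bits N) \<le> \<alpha> * real (num_bits N) + E N \<and>
            \<bar>E N\<bar> \<le> c * (real (num_bits N) powr (1/2) * ln (real (num_bits N))))))"
proof (rule exI[of _ 6], intro conjI allI impI)
  fix \<alpha> :: real assume \<alpha>: "0 < \<alpha> \<and> \<alpha> < 1"
  define E where "E N = 6 * (real (num_bits N) powr (1/2) * ln (real (num_bits N)))" for N
  define P where "P \<eta> N \<longleftrightarrow> N \<ge> 1 \<and> smooth (smooth_level \<alpha> N powr (1 + \<eta>)) N \<and>
      real (nonzero_bits N) \<le> \<alpha> * real (num_bits N) + E N" for \<eta> N
  have "\<exists>(S :: nat set) \<epsilon>. infinite S \<and> (\<epsilon> \<longlongrightarrow> 0) (inf at_top (principal S))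
      \<and> (\<forall>N\<in>S. P (\<epsilon> N) N)"
  proof (rule diagonal_sequence)
    show "\<exists>N\<ge>B. P \<eta> N" if "\<eta> > 0" for \<eta> B
      unfolding P_def E_def by (rule exists_sparse_smooth) (use \<alpha> that in auto)
  qed
  then obtain S \<epsilon> where S: "infinite S"
      "(\<epsilon> \<longlongrightarrow> 0) (inf at_top (principal S))" "\<forall>N\<in>S. P (\<epsilon> N) N"
    by (elim exE conjE) (rule that; assumption)
  have E: "\<bar>E N\<bar> \<le> 6 * (real (num_bits N) powr (1/2) * ln (real (num_bits N)))" if "N \<ge> 1" for N
  proof -
    have "Suc 0 \<le> num_bits N"
      unfolding num_bits_def using that by (intro floorlog_ge_SucI) auto
    then show ?thesis by (simp add: E_def)
  qed
  have main: "\<forall>N\<in>S. N \<ge> 1 \<and>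
            smooth (smooth_level \<alpha> N powr (1 + \<epsilon> N)) N \<and>
            real (nonzero_bits N) \<le> \<alpha> * real (num_bits N) + E N \<and>
            \<bar>E N\<bar> \<le> 6 * (real (num_bits N) powr (1/2) * ln (real (num_bits N)))"
  proof
    fix N assume "N \<in> S"
    with S(3) have "P (\<epsilon> N) N" by blast
    then show "N \<ge> 1 \<and>
            smooth (smooth_level \<alpha> N powr (1 + \<epsilon> N)) N \<and>
            real (nonzero_bits N) \<le> \<alpha> * real (num_bits N) + E N \<and>
            \<bar>E N\<bar> \<le> 6 * (real (num_bits N) powr (1/2) * ln (real (num_bits N)))"
      unfolding P_def using E by simp
  qed
  show "\<exists>(S :: nat set) (\<epsilon> :: nat \<Rightarrow> real) (E :: nat \<Rightarrow> real).
         infinite S \<and>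
         (\<epsilon> \<longlongrightarrow> 0) (inf at_top (principal S)) \<and>
         (\<forall>N\<in>S. N \<ge> 1 \<and>
            smooth (smooth_level \<alpha> N powr (1 + \<epsilon> N)) N \<and>
            real (nonzero_bits N) \<le> \<alpha> * real (num_bits N) + E N \<and>
            \<bar>E N\<bar> \<le> 6 * (real (num_bits N) powr (1/2) * ln (real (num_bits N))))"
    by (rule exI[of _ S], rule exI[of _ \<epsilon>], rule exI[of _ E]) (intro conjI S main)
qed simp

end
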